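(* Let $p\ge1$, $n\ge2$, let $x_1,\dots,x_n\in\mathbb R^p$, let $A'$ be a real-valued convex function on a set $\mathcal D\subset\mathbb R^p$ of natural parameters and $B':\mathbb R^p\to\mathbb R$ a function. For $\tau\in\{1,\dots,n-1\}$ and $\eta_1,\eta_2\in\mathcal D$ let $$\ell_{\tau,n}(\eta_1,\eta_2)=-\sum_{t=1}^{\tau}\big[A'(\eta_1)-2\langle x_t,\eta_1\rangle+B'(x_t)\big]-\sum_{t=\tau+1}^{n}\big[A'(\eta_2)-2\langle x_t,\eta_2\rangle+B'(x_t)\big].$$ For $1\le s\le p$ and $\eta_1\in\mathcal D$ let $$\hat\tau^{s}(\eta_1)\in\arg\max_{\tau\in\{1,\dots,n-1\}}\Big(\max_{\eta_2:\ \|\eta_1-\eta_2\|_0=s}\ell_{\tau,n}(\eta_1,\eta_2)\Big),\qquad \hat\tau^{s}(.)\in\arg\max_{\tau\in\{1,\dots,n-1\}}\Big(\max_{(\eta_1,\eta_2):\ \|\eta_1-\eta_2\|_0=s}\ell_{\tau,n}(\eta_1,\eta_2)\Big),$$ whenever these maxima are attained. Let $P(\tau)=\big(\tau,\sum_{t=1}^{\tau}x_t\big)\in\mathbb R^{p+1}$. Then for any $\eta_1\in\mathcal D$ and any $1\le s\le p$, taking $\hat\tau=\hat\tau^{s}(\eta_1)$ or $\hat\tau=\hat\tau^{s}(.)$, the point $P(\hat\tau)$ is on the convex hull of $\{P(\tau)\}_{\tau\in\{1,\dots,n-1\}}$, i.e. it lies on the boundary of this convex hull (it is not in its interior).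
   Context: $\|\mathbf v\|_0$ denotes the number of non-zero entries of the vector $\mathbf v$; $\langle\cdot,\cdot\rangle$ is the standard scalar product. The function $\ell_{\tau,n}$ is (twice) the log-likelihood, in a natural exponential family, of a model with a single change at $\tau$ from parameter $\eta_1$ to $\eta_2$. The boundary is taken in $\mathbb R^{p+1}$. *)

theory Defs
  imports "HOL-Analysis.Analysis"
begin

definition l0norm :: "real ^ 'p \<Rightarrow> nat" where
  "l0norm v = card {i. v $ i \<noteq> 0}"

definition loglik ::
  "(real ^ 'p \<Rightarrow> real) \<Rightarrow> (real ^ 'p \<Rightarrow> real) \<Rightarrow> (nat \<Rightarrow> real ^ 'p) \<Rightarrow> nat \<Rightarrow>
   nat \<Rightarrow> real ^ 'p \<Rightarrow> real ^ 'p \<Rightarrow> real" where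
  "loglik A' B' x n \<tau> \<eta>1 \<eta>2 =
     - (\<Sum>t = 1..\<tau>. A' \<eta>1 - 2 * (x t \<bullet> \<eta>1) + B' (x t))
     - (\<Sum>t = \<tau> + 1..n. A' \<eta>2 - 2 * (x t \<bullet> \<eta>2) + B' (x t))"

definition max_attained :: "('a \<Rightarrow> real) \<Rightarrow> 'a set \<Rightarrow> bool" where
  "max_attained f C \<longleftrightarrow> (\<exists>c. is_arg_max f (\<lambda>c. c \<in> C) c)"

text \<open>The term below is the maximum of \<open>f\<close> over \<open>C\<close> only when that maximum is attained;
  otherwise it is unspecified.\<close>

definition max_over :: "('a \<Rightarrow> real) \<Rightarrow> 'a set \<Rightarrow> real" where
  "max_over f C = (GREATEST m. m \<in> f ` C)"

text \<open>The maximisers over \<open>\<tau> \<in> {1..n - 1}\<close> of the maximum of \<open>f \<tau>\<close> over \<open>C\<close>.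
  Maximisers need not be unique, hence a set; it is empty unless all the inner maxima
  are attained.\<close>

definition argmax_profile :: "nat \<Rightarrow> (nat \<Rightarrow> 'a \<Rightarrow> real) \<Rightarrow> 'a set \<Rightarrow> nat set" where
  "argmax_profile n f C =
     {\<tau>. (\<forall>\<tau>' \<in> {1..n - 1}. max_attained (f \<tau>') C) \<and>
         is_arg_max (\<lambda>\<tau>'. max_over (f \<tau>') C) (\<lambda>\<tau>'. \<tau>' \<in> {1..n - 1}) \<tau>}"

definition tau_hat_known ::
  "(real ^ 'p) set \<Rightarrow> (real ^ 'p \<Rightarrow> real) \<Rightarrow> (real ^ 'p \<Rightarrow> real) \<Rightarrow> (nat \<Rightarrow> real ^ 'p) \<Rightarrow> nat \<Rightarrow>
   nat \<Rightarrow> real ^ 'p \<Rightarrow> nat set" where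
  "tau_hat_known D A' B' x n s \<eta>1 =
     argmax_profile n (\<lambda>\<tau> \<eta>2. loglik A' B' x n \<tau> \<eta>1 \<eta>2) {\<eta>2 \<in> D. l0norm (\<eta>1 - \<eta>2) = s}"

definition tau_hat_unknown ::
  "(real ^ 'p) set \<Rightarrow> (real ^ 'p \<Rightarrow> real) \<Rightarrow> (real ^ 'p \<Rightarrow> real) \<Rightarrow> (nat \<Rightarrow> real ^ 'p) \<Rightarrow> nat \<Rightarrow>
   nat \<Rightarrow> nat set" where
  "tau_hat_unknown D A' B' x n s =
     argmax_profile n (\<lambda>\<tau> (\<eta>1, \<eta>2). loglik A' B' x n \<tau> \<eta>1 \<eta>2)
       {(\<eta>1, \<eta>2). \<eta>1 \<in> D \<and> \<eta>2 \<in> D \<and> l0norm (\<eta>1 - \<eta>2) = s}"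

text \<open>The space \<open>\<real>\<^sup>p\<^sup>+\<^sup>1\<close> is rendered as the Euclidean product space \<open>real \<times> real ^ 'p\<close>.\<close>

definition cusum_point :: "(nat \<Rightarrow> real ^ 'p) \<Rightarrow> nat \<Rightarrow> real \<times> (real ^ 'p)" where
  "cusum_point x \<tau> = (real \<tau>, \<Sum>t = 1..\<tau>. x t)"

end

theory Submission imports Defs begin

text \<open>For fixed parameters \<open>\<eta>1\<close>, \<open>\<eta>2\<close> the log-likelihood is an affine function of the point
  \<open>P(\<tau>)\<close>, with normal vector \<open>(A'(\<eta>2) - A'(\<eta>1), 2 (\<eta>1 - \<eta>2))\<close>, which is nonzero as soon as
  \<open>\<eta>1 \<noteq> \<eta>2\<close>. If \<open>\<tau>\<close> maximises the profile likelihood and \<open>(\<eta>1, \<eta>2)\<close> attains the inner maximum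
  at \<open>\<tau>\<close>, then \<open>\<tau>\<close> also maximises the likelihood with these parameters held fixed, so \<open>P(\<tau>)\<close>
  lies on a supporting hyperplane of the convex hull.\<close>

text \<open>The hull stays inside a closed half-space, whose interior is the open half-space because
  \<open>w\<close> is nonzero. The point \<open>a\<close> lies on the bounding hyperplane, hence
  outside that interior.\<close>

lemma inner_maximizer_in_frontier_convex_hull:
  fixes S :: "'a :: euclidean_space set"
  assumes "a \<in> S" "w \<noteq> 0" "\<And>y. y \<in> S \<Longrightarrow> w \<bullet> y \<le> w \<bullet> a"
  shows "a \<in> frontier (convex hull S)"
proof -
  have "convex hull S \<subseteq> {y. w \<bullet> y \<le> w \<bullet> a}"
    using assms(3) by (intro hull_minimal) (auto simp: convex_halfspace_le)
  then have "interior (convex hull S) \<subseteq> {y. w \<bullet> y < w \<bullet> a}"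
    using interior_mono interior_halfspace_le[OF assms(2)] by metis
  then have "a \<notin> interior (convex hull S)"
    by auto
  moreover have "a \<in> closure (convex hull S)"
    using hull_subset[of S convex] closure_subset assms(1) by blast
  ultimately show ?thesis
    by (simp add: frontier_def)
qed

lemma is_arg_max_imp_max_over_eq:
  assumes "is_arg_max f (\<lambda>c. c \<in> C) c"
  shows "max_over f C = f c"
  unfolding max_over_def using assms
  by (intro Greatest_equality) (auto simp: is_arg_max_linorder)

lemma le_max_over:
  assumes "max_attained f C" "c \<in> C"
  shows "f c \<le> max_over f C"
proof -
  obtain d where d: "is_arg_max f (\<lambda>c. c \<in> C) d"
    using assms(1) unfolding max_attained_def by blast
  then show ?thesis
    using assms(2) is_arg_max_imp_max_over_eq[OF d] by (simp add: is_arg_max_linorder)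
qed

text \<open>Exchanges the two maximisations: a \<open>c\<close> attaining the inner maximum at the
  optimal \<tau> is kept fixed, and its value at any other \<tau>' is at most the profile there.
  Attainment at every \<tau>' matters, since \<open>max_over\<close> is unspecified
  otherwise.\<close>

lemma argmax_profileE:
  assumes "\<tau> \<in> argmax_profile n f C"
  obtains c where "c \<in> C" "\<tau> \<in> {1..n - 1}"
    "\<And>\<tau>'. \<tau>' \<in> {1..n - 1} \<Longrightarrow> f \<tau>' c \<le> f \<tau> c"
proof -
  have att: "max_attained (f \<tau>') C" if "\<tau>' \<in> {1..n - 1}" for \<tau>'
    using assms that by (simp add: argmax_profile_def)
  have \<tau>: "\<tau> \<in> {1..n - 1}"
    and opt: "\<And>\<tau>'. \<tau>' \<in> {1..n - 1} \<Longrightarrow> max_over (f \<tau>') C \<le> max_over (f \<tau>) C"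
    using assms by (auto simp: argmax_profile_def is_arg_max_linorder)
  obtain c where c: "is_arg_max (f \<tau>) (\<lambda>c. c \<in> C) c"
    using att[OF \<tau>] unfolding max_attained_def by blast
  then have cC: "c \<in> C"
    by (simp add: is_arg_max_def)
  show thesis
  proof (rule that[OF cC \<tau>])
    fix \<tau>' assume \<tau>': "\<tau>' \<in> {1..n - 1}"
    have "f \<tau>' c \<le> max_over (f \<tau>') C"
      using le_max_over[OF att[OF \<tau>'] cC] .
    also have "\<dots> \<le> max_over (f \<tau>) C"
      using opt[OF \<tau>'] .
    also have "\<dots> = f \<tau> c"
      using is_arg_max_imp_max_over_eq[OF c] .
    finally show "f \<tau>' c \<le> f \<tau> c" .
  qed
qed

text \<open>Compare with the model that uses \<eta>2 throughout: its value does not depend on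
  \<tau>, and only the first \<tau> summands differ.\<close>

lemma loglik_eq_inner_cusum_point:
  assumes "\<tau> \<le> n"
  shows "loglik A' B' x n \<tau> \<eta>1 \<eta>2 =
    (A' \<eta>2 - A' \<eta>1, 2 *\<^sub>R (\<eta>1 - \<eta>2)) \<bullet> cusum_point x \<tau>
    - (\<Sum>t = 1..n. A' \<eta>2 - 2 * (x t \<bullet> \<eta>2) + B' (x t))"
proof -
  have "(\<Sum>t = 1..n. g t) = (\<Sum>t = 1..\<tau>. g t) + (\<Sum>t = \<tau> + 1..n. g t)" for g :: "nat \<Rightarrow> real"
    using sum.ub_add_nat[of 1 \<tau> g "n - \<tau>"] assms by simp
  \<comment> \<open>The \<open>B'\<close> terms cancel, and summing the constant \<open>A'\<close>
    difference produces the factor \<tau>, the first coordinate of the point.\<close>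
  moreover have "(A' \<eta>2 - A' \<eta>1, 2 *\<^sub>R (\<eta>1 - \<eta>2)) \<bullet> cusum_point x \<tau> =
      (\<Sum>t = 1..\<tau>. A' \<eta>2 - 2 * (x t \<bullet> \<eta>2) + B' (x t))
      - (\<Sum>t = 1..\<tau>. A' \<eta>1 - 2 * (x t \<bullet> \<eta>1) + B' (x t))"
    by (simp add: cusum_point_def inner_sum_right inner_diff_left inner_commute sum.distrib
        sum_subtractf sum_distrib_left algebra_simps)
  ultimately show ?thesis
    unfolding loglik_def by simp
qed

lemma cusum_point_in_frontier:
  assumes "\<eta>1 \<noteq> \<eta>2" "\<tau> \<in> {1..n - 1}"
    and "\<And>\<tau>'. \<tau>' \<in> {1..n - 1} \<Longrightarrow> loglik A' B' x n \<tau>' \<eta>1 \<eta>2 \<le> loglik A' B' x n \<tau> \<eta>1 \<eta>2"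
  shows "cusum_point x \<tau> \<in> frontier (convex hull (cusum_point x ` {1..n - 1}))"
proof (rule inner_maximizer_in_frontier_convex_hull)
  let ?w = "(A' \<eta>2 - A' \<eta>1, 2 *\<^sub>R (\<eta>1 - \<eta>2))"
  show "cusum_point x \<tau> \<in> cusum_point x ` {1..n - 1}"
    using assms(2) by (rule imageI)
  \<comment> \<open>The second component is already nonzero, whatever values \<open>A'\<close>
    takes.\<close>
  show "?w \<noteq> 0"
    using assms(1) by (simp add: zero_prod_def)
  show "?w \<bullet> y \<le> ?w \<bullet> cusum_point x \<tau>" if y: "y \<in> cusum_point x ` {1..n - 1}" for y
  proof -
    obtain \<tau>' where \<tau>': "\<tau>' \<in> {1..n - 1}" "y = cusum_point x \<tau>'"
      using y by blast
    moreover have "\<tau> \<le> n" "\<tau>' \<le> n"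
      using assms(2) \<tau>'(1) by auto
    ultimately show ?thesis
      \<comment> \<open>The subtracted sum is the same for \<tau> and \<tau>', so it drops out of
        the inequality.\<close>
      using assms(3)[OF \<tau>'(1)] by (simp only: loglik_eq_inner_cusum_point)
  qed
qed

lemma neq_if_l0norm_diff_pos: "0 < l0norm (a - b) \<Longrightarrow> a \<noteq> b"
  by (auto simp: l0norm_def)

theorem theorem5:
  fixes x :: "nat \<Rightarrow> real ^ 'p" and n s :: nat
    and D :: "(real ^ 'p) set" and A' B' :: "real ^ 'p \<Rightarrow> real"
  assumes "n \<ge> 2"
    and "convex_on D A'"
    and "1 \<le> s" and "s \<le> CARD('p)"
  shows "(\<forall>\<eta>1 \<in> D. \<forall>\<tau> \<in> tau_hat_known D A' B' x n s \<eta>1.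
            cusum_point x \<tau> \<in> frontier (convex hull (cusum_point x ` {1..n - 1}))) \<and>
         (\<forall>\<tau> \<in> tau_hat_unknown D A' B' x n s.
            cusum_point x \<tau> \<in> frontier (convex hull (cusum_point x ` {1..n - 1})))"
proof (intro conjI ballI)
  fix \<eta>1 \<tau>
  assume "\<tau> \<in> tau_hat_known D A' B' x n s \<eta>1"
  then obtain \<eta>2 where "l0norm (\<eta>1 - \<eta>2) = s" and max: "\<tau> \<in> {1..n - 1}"
    "\<And>\<tau>'. \<tau>' \<in> {1..n - 1} \<Longrightarrow> loglik A' B' x n \<tau>' \<eta>1 \<eta>2 \<le> loglik A' B' x n \<tau> \<eta>1 \<eta>2"
    unfolding tau_hat_known_def by (elim argmax_profileE) blast
  \<comment> \<open>Here \<open>1 \<le> s\<close> enters: the parameters differ in at least one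
    coordinate.\<close>
  then have "\<eta>1 \<noteq> \<eta>2"
    using assms(3) by (intro neq_if_l0norm_diff_pos) simp
  then show "cusum_point x \<tau> \<in> frontier (convex hull (cusum_point x ` {1..n - 1}))"
    using max by (rule cusum_point_in_frontier)
next
  fix \<tau>
  assume "\<tau> \<in> tau_hat_unknown D A' B' x n s"
  \<comment> \<open>The inner maximiser is now a pair; both parameters stay fixed while \<tau>'
    varies.\<close>
  then obtain \<eta>1 \<eta>2 where "l0norm (\<eta>1 - \<eta>2) = s" and max: "\<tau> \<in> {1..n - 1}"
    "\<And>\<tau>'. \<tau>' \<in> {1..n - 1} \<Longrightarrow> loglik A' B' x n \<tau>' \<eta>1 \<eta>2 \<le> loglik A' B' x n \<tau> \<eta>1 \<eta>2"
    unfolding tau_hat_unknown_def by (elim argmax_profileE) fastforce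
  then have "\<eta>1 \<noteq> \<eta>2"
    using assms(3) by (intro neq_if_l0norm_diff_pos) simp
  then show "cusum_point x \<tau> \<in> frontier (convex hull (cusum_point x ` {1..n - 1}))"
    using max by (rule cusum_point_in_frontier)
qed

end
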